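(* Let $n\ge1$. There exists a constant $C$ such that every $\alpha\in S^n$ is $(C,1/2,1/2)$-uniformly Dirichlet in $S^n$; that is, for every $\alpha\in S^n$ and every real $N>1$ there exists $(\mathbf{p},q)\in\mathbb{Z}^{n+1}\times\mathbb{N}$ with $\frac{\mathbf{p}}{q}\in S^n$, $q\le N$ and $$\left\|\alpha-\frac{\mathbf{p}}{q}\right\|<\frac{C}{q^{1/2}N^{1/2}}.$$
   Context: $S^n\subset\mathbb{R}^{n+1}$ is the Euclidean unit sphere and $\|\cdot\|$ is the supremum norm on $\mathbb{R}^{n+1}$. For $X\subset\mathbb{R}^{n+1}$ and real $C,a,b$, a point $\alpha\in X$ is called $(C,a,b)$-uniformly Dirichlet in $X$ if for every $N>1$ there exists a rational point $\frac{\mathbf{p}}{q}\in X$ with $q\le N$ and $\|\alpha-\frac{\mathbf{p}}{q}\|<\frac{C}{q^aN^b}$. *)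

theory Defs
  imports "HOL-Analysis.Analysis"
begin

definition rational_point :: "int ^ 'k \<Rightarrow> nat \<Rightarrow> real ^ 'k" where
  "rational_point p q = (\<chi> i. real_of_int (p $ i) / real q)"

(* The library's infnorm is the supremum norm; norm, and with it sphere, is Euclidean.
   The denominator q has to be positive because x / 0 = 0.  The representation of a
   rational point by (p, q) need not be in lowest terms. *)
definition uniformly_Dirichlet ::
    "real \<Rightarrow> real \<Rightarrow> real \<Rightarrow> (real ^ 'k) set \<Rightarrow> real ^ 'k \<Rightarrow> bool" where
  "uniformly_Dirichlet C a b X \<alpha> \<longleftrightarrow> \<alpha> \<in> X \<and>
     (\<forall>N::real. N > 1 \<longrightarrow>
       (\<exists>(p :: int ^ 'k) (q :: nat). q > 0 \<and> rational_point p q \<in> X \<and> real q \<le> N \<and>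
          infnorm (\<alpha> - rational_point p q) < C / (real q powr a * N powr b)))"

end

theory Submission imports Defs begin

text \<open>
  A rational point of the sphere is an integer vector \<open>(p, q)\<close> that is isotropic for the
  Lorentz form \<open>Q\<close>, and since \<open>|p - q \<alpha>|\<^sup>2 = 2 q (q - \<alpha> \<bullet> p)\<close> it suffices to find one with
  \<open>q \<le> N\<close> and \<open>q - \<alpha> \<bullet> p = O(1/N)\<close>. Both conditions say that \<open>(p, q)\<close> has bounded Lorentz
  product with the point \<open>\<eta>\<close> of hyperbolic space on the geodesic towards \<open>\<alpha>\<close> at distance about
  \<open>ln N\<close>. So, with \<open>\<rho>\<close> the Lorentz reflection that sends \<open>\<eta>\<close> to the time axis, one needs a
  nonzero isotropic integer vector \<open>a\<close> for which \<open>norm (\<rho> a)\<close> is bounded independently of \<open>\<eta>\<close>.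

  This is obtained by the descent of Cassels' theorem on small zeros of quadratic forms. If
  \<open>norm (\<rho> a)\<close> is large, Minkowski's argument in a tube around the line through \<open>a\<close> (of large
  volume, as \<open>\<rho>\<close> preserves volume) gives an integer vector \<open>b = l a + c\<close> with \<open>l\<close> and
  \<open>\<rho> c\<close> at most \<open>1/2\<close> in size. The vector \<open>Q(b,b) a - 2 Q(a,b) b = Q(c,c) a - 2 Q(a,c) c\<close> is
  integral, isotropic and shorter than \<open>a\<close>; if it vanishes, then \<open>b\<close> itself is isotropic and
  shorter than \<open>a\<close>.
\<close>

section \<open>Integer vectors and Blichfeldt's theorem\<close>

definition integer_vectors :: "(real ^ 'n) set" where
  "integer_vectors = {x. \<forall>i. x $ i \<in> \<int>}"

lemma countable_integer_vectors: "countable (integer_vectors :: (real ^ 'n) set)"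
  unfolding integer_vectors_def by (rule countable_vector) (simp add: Ints_def)

lemma integer_vectors_diff:
  "x \<in> integer_vectors \<Longrightarrow> y \<in> integer_vectors \<Longrightarrow> x - y \<in> integer_vectors"
  by (simp add: integer_vectors_def)

lemma integer_vectors_scaleR:
  "c \<in> \<int> \<Longrightarrow> x \<in> integer_vectors \<Longrightarrow> c *\<^sub>R x \<in> integer_vectors"
  by (simp add: integer_vectors_def)

text \<open>Cut \<open>S\<close> along the integer translates of the unit cell and move every piece
  back into that cell. If no two distinct points of \<open>S\<close> differed by an integer vector,
  the moved pieces would be disjoint inside a cube of volume 1.\<close>

theorem Blichfeldt:
  fixes S :: "(real ^ 'n) set"
  assumes S: "S \<in> sets lebesgue" and vol: "emeasure lebesgue S > 1"
  obtains x y where "x \<in> S" "y \<in> S" "x \<noteq> y" "x - y \<in> integer_vectors"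
proof -
  have "\<exists>x\<in>S. \<exists>y\<in>S. x \<noteq> y \<and> x - y \<in> integer_vectors"
  proof (rule ccontr)
    assume contra: "\<not> ?thesis"
    \<comment> \<open>Half-open, so that the integer translates tile space: the corner of the
      translate containing \<open>x\<close> is the coordinatewise floor of \<open>x\<close>.\<close>
    define cell :: "(real ^ 'n) set" where "cell = {x. \<forall>i. 0 \<le> x $ i \<and> x $ i < 1}"
    define X where "X z = S \<inter> (+) z ` cell" for z
    define Y where "Y z = (+) (- z) ` X z" for z
    have cell: "cell \<in> sets lebesgue"
    proof -
      have "cell = (\<Inter>i. {x. 0 \<le> x $ i} - {x. 1 \<le> x $ i})"
        by (rule set_eqI) (simp add: cell_def not_le)
      also have "\<dots> \<in> sets borel"
        by (intro sets.countable_INT'' sets.Diff borel_closed closed_Collect_le continuous_intros) auto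
      finally show ?thesis by simp
    qed
    have X: "X z \<in> sets lebesgue" for z
      unfolding X_def using S cell by (intro sets.Int lebesgue_sets_translation) auto
    have Y: "Y z \<in> sets lebesgue" for z
      unfolding Y_def using X by (rule lebesgue_sets_translation)
    have eqXY: "emeasure lebesgue (X z) = emeasure lebesgue (Y z)" for z
      using emeasure_lebesgue_affine[of 1 "- z" "X z"] by (simp add: Y_def add.commute)
    have floor_mem: "(\<chi> i. of_int \<lfloor>x $ i\<rfloor>) \<in> integer_vectors" for x :: "real ^ 'n"
      by (simp add: integer_vectors_def)
    have cell_unique: "z = (\<chi> i. of_int \<lfloor>x $ i\<rfloor>)"
      if z: "z \<in> integer_vectors" and x: "x \<in> (+) z ` cell" for x z
    proof -
      obtain u where u: "x = z + u" "u \<in> cell" using x by blast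
      show ?thesis
      proof (subst vec_eq_iff, rule allI)
        fix i
        obtain k where k: "z $ i = of_int k"
          using z by (auto simp: integer_vectors_def elim: Ints_cases)
        have "0 \<le> u $ i" "u $ i < 1" using u by (auto simp: cell_def)
        then have "\<lfloor>x $ i\<rfloor> = k" using u k by (simp add: floor_unique)
        then show "z $ i = (\<chi> i. of_int \<lfloor>x $ i\<rfloor>) $ i" using k by simp
      qed
    qed
    have cell_exists: "x \<in> (+) (\<chi> i. of_int \<lfloor>x $ i\<rfloor>) ` cell" for x
      by (rule image_eqI[where x="x - (\<chi> i. of_int \<lfloor>x $ i\<rfloor>)"])
        (auto simp: cell_def, linarith)
    have S_eq: "S = (\<Union>z\<in>integer_vectors. X z)"
      unfolding X_def using cell_exists floor_mem by blast
    have disjX: "disjoint_family_on X integer_vectors"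
      unfolding disjoint_family_on_def X_def using cell_unique by blast
    have disjY: "disjoint_family_on Y integer_vectors"
      unfolding disjoint_family_on_def
    proof (intro ballI impI equals0I)
      fix z w u
      assume zw: "z \<in> integer_vectors" "w \<in> integer_vectors" "z \<noteq> w" and u: "u \<in> Y z \<inter> Y w"
      have "z + u \<in> S" "w + u \<in> S"
        using u by (auto simp: Y_def X_def)
      moreover have "(z + u) - (w + u) \<in> integer_vectors"
        using integer_vectors_diff[of z w] zw by simp
      ultimately show False using contra zw(3) by (metis add_right_cancel)
    qed
    have "emeasure lebesgue S = (\<integral>\<^sup>+z. emeasure lebesgue (X z) \<partial>count_space integer_vectors)"
      unfolding S_eq using X disjX countable_integer_vectors by (intro emeasure_UN_countable)
    also have "\<dots> = emeasure lebesgue (\<Union>z\<in>integer_vectors. Y z)"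
      unfolding eqXY using Y disjY countable_integer_vectors by (intro emeasure_UN_countable[symmetric])
    also have "\<dots> \<le> emeasure lebesgue (cbox 0 1 :: (real ^ 'n) set)"
      by (rule emeasure_mono) (auto simp: Y_def X_def cell_def mem_box_cart less_imp_le)
    also have "\<dots> = 1"
    proof -
      have "1 \<bullet> b = (1::real)" if "b \<in> Basis" for b :: "real ^ 'n"
        using that by (auto simp: Basis_vec_def inner_axis)
      then show ?thesis by (simp add: emeasure_lborel_cbox_eq)
    qed
    finally show False using vol by simp
  qed
  then show thesis using that by blast
qed

section \<open>The Lorentz form with time coordinate \<open>t\<close>\<close>

definition lorentz :: "'n \<Rightarrow> real ^ 'n \<Rightarrow> real ^ 'n \<Rightarrow> real" where
  "lorentz t x y = x \<bullet> y - 2 * (x $ t) * (y $ t)"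

lemma lorentz_add_left: "lorentz t (x + y) z = lorentz t x z + lorentz t y z"
  and lorentz_add_right: "lorentz t z (x + y) = lorentz t z x + lorentz t z y"
  and lorentz_diff_left: "lorentz t (x - y) z = lorentz t x z - lorentz t y z"
  and lorentz_diff_right: "lorentz t z (x - y) = lorentz t z x - lorentz t z y"
  and lorentz_scaleR_left: "lorentz t (c *\<^sub>R x) z = c * lorentz t x z"
  and lorentz_scaleR_right: "lorentz t z (c *\<^sub>R x) = c * lorentz t z x"
  by (simp_all add: lorentz_def inner_simps algebra_simps)

lemmas lorentz_simps = lorentz_add_left lorentz_add_right lorentz_diff_left lorentz_diff_right
  lorentz_scaleR_left lorentz_scaleR_right

lemma lorentz_commute: "lorentz t x y = lorentz t y x"
  by (simp add: lorentz_def inner_commute)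

lemma lorentz_Ints:
  "x \<in> integer_vectors \<Longrightarrow> y \<in> integer_vectors \<Longrightarrow> lorentz t x y \<in> \<int>"
  by (auto simp: lorentz_def inner_vec_def integer_vectors_def intro!: Ints_diff Ints_mult Ints_sum)

text \<open>Cauchy-Schwarz, after flipping the sign of the time coordinate of \<open>y\<close>: this
  turns the form into the inner product and keeps the norm.\<close>

lemma abs_lorentz_le: "\<bar>lorentz t x y\<bar> \<le> norm x * norm y"
proof -
  define y' where "y' = (\<chi> i. if i = t then - (y $ i) else y $ i)"
  have "lorentz t x y = (\<Sum>i\<in>UNIV. x $ i * y $ i - (if i = t then 2 * (x $ t) * (y $ t) else 0))"
    by (simp add: lorentz_def inner_vec_def sum_subtractf)
  also have "\<dots> = x \<bullet> y'"
    unfolding inner_vec_def y'_def by (rule sum.cong) auto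
  finally have "\<bar>lorentz t x y\<bar> \<le> norm x * norm y'"
    using Cauchy_Schwarz_ineq2 by metis
  moreover have "norm y' = norm y"
    unfolding norm_vec_def y'_def by (auto intro: L2_set_cong)
  ultimately show ?thesis by simp
qed

section \<open>Minkowski's argument and the descent on isotropic integer vectors\<close>

lemma Minkowski_tube:
  fixes \<rho> :: "real ^ 'n::{finite,wellorder} \<Rightarrow> real ^ 'n::_" and a :: "real ^ 'n::_"
  assumes lin: "linear \<rho>" and inv: "\<And>x. \<rho> (\<rho> x) = x"
    and long: "norm (\<rho> a) > 2 * (2 * CARD('n)) ^ (CARD('n) - 1)"
  obtains b c l where "b \<in> integer_vectors" "b \<noteq> 0" "b = l *\<^sub>R a + c" "\<bar>l\<bar> \<le> 1/2" "norm (\<rho> c) \<le> 1/2"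
proof -
  define A where "A = norm (\<rho> a)"
  define d where "d = real CARD('n)"
  have d: "d \<ge> 1" by (simp add: d_def Suc_leI)
  have A: "A > 0" using long unfolding A_def
    by (rule le_less_trans[rotated]) simp
  obtain k :: 'n where True by blast
  \<comment> \<open>\<open>\<sigma>\<close> turns the \<open>k\<close>-th axis towards
    \<open>\<rho> a\<close>; as \<open>\<rho>\<close> is an involution, \<open>f\<close> below then
    sends the unit vector of that axis to \<open>a\<close> divided by \<open>A\<close>.\<close>
  obtain \<sigma> :: "real ^ 'n::_ \<Rightarrow> real ^ 'n::_" where \<sigma>: "orthogonal_transformation \<sigma>" and \<sigma>a: "\<sigma> (axis k 1) = \<rho> a /\<^sub>R A"
    using orthogonal_transformation_exists_1[of "axis k 1 :: real ^ 'n::_" "\<rho> a /\<^sub>R A"] A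
    by (auto simp: A_def norm_axis_1)
  have lin\<sigma>: "linear \<sigma>" using \<sigma> by (rule orthogonal_transformation_linear)
  \<comment> \<open>For a difference of two points of \<open>B\<close>, the long side makes the
    coefficient of \<open>a\<close> at most 1/2, and the short sides keep the sum of the other
    coordinates, hence their norm, at most 1/2. The volume is
    \<open>A / (2 * (2 * d) ^ (CARD('n) - 1))\<close>, which \<open>long\<close> puts above
    1.\<close>
  define B :: "(real ^ 'n::_) set" where "B = cbox 0 (\<chi> i. if i = k then A / 2 else 1 / (2 * d))"
  define f where "f = \<rho> \<circ> \<sigma>"
  have linf: "linear f" unfolding f_def using lin lin\<sigma> by (rule linear_compose[rotated])
  \<comment> \<open>An involution has determinant 1 or -1, so \<open>\<rho>\<close> preserves
    volume.\<close>
  have "det (matrix \<rho>) * det (matrix \<rho>) = det (matrix (\<rho> \<circ> \<rho>))"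
    by (simp add: matrix_compose[OF lin lin] det_mul)
  also have "\<rho> \<circ> \<rho> = id" using inv by auto
  finally have "det (matrix \<rho>) * det (matrix \<rho>) = 1" by (simp only: matrix_id_mat_1 det_I)
  then have det\<rho>: "\<bar>det (matrix \<rho>)\<bar> = 1"
    by (simp add: abs_square_eq_1[symmetric] power2_eq_square)
  have mB: "B \<in> lmeasurable" by (simp add: B_def)
  have "measure lebesgue (f ` B) = \<bar>det (matrix \<rho>)\<bar> * measure lebesgue (\<sigma> ` B)"
    unfolding f_def image_comp[symmetric]
    by (rule measure_linear_image[OF lin measurable_orthogonal_image[OF \<sigma> mB]])
  also have "\<dots> = measure lebesgue B"
    using measure_orthogonal_image[OF \<sigma> mB] det\<rho> by simp
  also have "\<dots> = (\<Prod>i\<in>UNIV. if i = k then A / 2 else 1 / (2 * d))"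
    unfolding B_def using A d
    by (subst measure_completion) (auto simp: content_cbox_if_cart interval_eq_empty_cart not_less intro!: prod.cong split: if_splits)
  also have "\<dots> = A / 2 * (\<Prod>i\<in>UNIV - {k}. 1 / (2 * d))"
    by (subst prod.remove[of UNIV k]) (auto intro!: prod.cong)
  also have "\<dots> = A / (2 * (2 * d) ^ (CARD('n) - 1))"
    by (simp add: power_one_over card_Diff_singleton)
  also have "\<dots> > 1"
    using long d by (simp add: A_def d_def)
  finally have m1: "measure lebesgue (f ` B) > 1" .
  have mf: "f ` B \<in> lmeasurable" using linf mB by (rule measurable_linear_image)
  have "emeasure lebesgue (f ` B) > 1"
    using m1 fmeasurableD2[OF mf] by (subst emeasure_eq_ennreal_measure) auto
  then obtain x y where xy: "x \<in> f ` B" "y \<in> f ` B" "x \<noteq> y" "x - y \<in> integer_vectors"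
    using Blichfeldt fmeasurableD[OF mf] by blast
  then obtain u v where uv: "u \<in> B" "v \<in> B" "x = f u" "y = f v" by blast
  define w where "w = u - v"
  define l where "l = w $ k / A"
  define w' where "w' = w - (w $ k) *\<^sub>R axis k 1"
  have side: "0 \<le> z $ i \<and> z $ i \<le> (if i = k then A / 2 else 1 / (2 * d))" if "z \<in> B" for z i
    using that by (simp add: B_def mem_box_cart)
  have wi: "\<bar>w $ i\<bar> \<le> (if i = k then A / 2 else 1 / (2 * d))" for i
    unfolding w_def vector_minus_component using side[OF uv(1), of i] side[OF uv(2), of i] by linarith
  have wk: "\<bar>w $ k\<bar> \<le> A / 2"
    using wi[of k] by simp
  have w'i: "\<bar>w' $ i\<bar> \<le> 1 / (2 * d)" for i
  proof (cases "i = k")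
    case True
    then show ?thesis using d by (simp add: w'_def)
  next
    case False
    then show ?thesis using wi[of i] by (simp add: w'_def axis_def)
  qed
  have "norm w' \<le> (\<Sum>i\<in>UNIV. \<bar>w' $ i\<bar>)" by (rule norm_le_l1_cart)
  also have "\<dots> \<le> (\<Sum>i\<in>(UNIV::'n set). 1 / (2 * d))" by (rule sum_mono) (rule w'i)
  also have "\<dots> = 1/2" using d by (simp add: d_def)
  finally have nw': "norm w' \<le> 1/2" .
  have fw: "x - y = f w" using uv linear_diff[OF linf] by (simp add: w_def)
  have fk: "f (axis k 1) = a /\<^sub>R A"
    using \<sigma>a lin inv by (simp add: f_def linear_scale)
  have "w = (w $ k) *\<^sub>R axis k 1 + w'" by (simp add: w'_def)
  then have "f w = (w $ k) *\<^sub>R f (axis k 1) + f w'"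
    using linf by (metis linear_add linear_scale)
  then have "x - y = l *\<^sub>R a + f w'" by (simp add: fw fk l_def divide_inverse)
  moreover have "\<bar>l\<bar> \<le> 1/2" using wk A by (simp add: l_def abs_divide field_simps)
  moreover have "norm (\<rho> (f w')) \<le> 1/2"
    using nw' \<sigma> inv by (simp add: f_def orthogonal_transformation_norm)
  moreover have "x - y \<noteq> 0" using xy by simp
  ultimately show thesis using that xy(4) by blast
qed

text \<open>The factor 3/4 covers both outcomes. If \<open>v\<close> is nonzero, its two terms
  contribute at most 1/4 and 1/2 of \<open>norm (\<rho> a)\<close>. If \<open>v = 0\<close>, then
  \<open>norm (\<rho> b)\<close> is at most half of \<open>norm (\<rho> a)\<close> plus 1/2, and
  \<open>long\<close> provides \<open>norm (\<rho> a) \<ge> 2\<close>.\<close>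

lemma isotropic_descent:
  fixes \<rho> :: "real ^ 'n::{finite,wellorder} \<Rightarrow> real ^ 'n::_"
  assumes lin: "linear \<rho>" and inv: "\<And>x. \<rho> (\<rho> x) = x"
    and isom: "\<And>x y. lorentz t (\<rho> x) (\<rho> y) = lorentz t x y"
    and a: "a \<in> integer_vectors" "a \<noteq> 0" "lorentz t a a = 0"
    and long: "norm (\<rho> a) > 2 * (2 * CARD('n)) ^ (CARD('n) - 1)"
  obtains a' where "a' \<in> integer_vectors" "a' \<noteq> 0" "lorentz t a' a' = 0"
    "norm (\<rho> a') \<le> 3/4 * norm (\<rho> a)"
proof -
  have "(1::nat) \<le> (2 * CARD('n)) ^ (CARD('n) - 1)" by (simp add: Suc_leI)
  then have "(2::real) \<le> real (2 * (2 * CARD('n)) ^ (CARD('n) - 1))"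
    by linarith
  then have two: "norm (\<rho> a) \<ge> 2" using long by linarith
  obtain b c l where b: "b \<in> integer_vectors" "b \<noteq> 0" and blc: "b = l *\<^sub>R a + c"
    and l: "\<bar>l\<bar> \<le> 1/2" and c: "norm (\<rho> c) \<le> 1/2"
    using Minkowski_tube[OF lin inv long] by blast
  \<comment> \<open>up to the factor \<open>lorentz t b b\<close>, the reflection of \<open>a\<close> in the hyperplane orthogonal to \<open>b\<close>\<close>
  define v where "v = lorentz t b b *\<^sub>R a - (2 * lorentz t a b) *\<^sub>R b"
  have v_int: "v \<in> integer_vectors"
    unfolding v_def using a(1) b(1)
    by (intro integer_vectors_diff integer_vectors_scaleR Ints_mult lorentz_Ints) auto
  have v_iso: "lorentz t v v = 0"
    using a(3) lorentz_commute[of t b a] unfolding v_def by (simp add: lorentz_simps algebra_simps)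
  have "lorentz t b b = 2 * l * lorentz t a c + lorentz t c c" "lorentz t a b = lorentz t a c"
    using a(3) by (simp_all add: blc lorentz_simps lorentz_commute[of t c a])
  \<comment> \<open>The terms with \<open>l\<close> cancel because \<open>a\<close> is isotropic, so
    \<open>v\<close> is quadratic in the small vector \<open>c\<close>.\<close>
  then have v_eq: "v = lorentz t c c *\<^sub>R a - (2 * lorentz t a c) *\<^sub>R c"
    unfolding v_def by (simp add: blc algebra_simps)
  show thesis
  proof (cases "v = 0")
    case False
    have lor_le: "\<bar>lorentz t x y\<bar> \<le> norm (\<rho> x) * norm (\<rho> y)" for x y
      using abs_lorentz_le[of t "\<rho> x" "\<rho> y"] isom by simp
    have "norm (\<rho> v) \<le> \<bar>lorentz t c c\<bar> * norm (\<rho> a) + \<bar>2 * lorentz t a c\<bar> * norm (\<rho> c)"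
      unfolding v_eq linear_diff[OF lin] linear_scale[OF lin]
      by (rule order_trans[OF norm_triangle_ineq4]) simp
    also have "\<dots> \<le> (norm (\<rho> c) * norm (\<rho> c)) * norm (\<rho> a) + (2 * (norm (\<rho> a) * norm (\<rho> c))) * norm (\<rho> c)"
      using lor_le[of c c] lor_le[of a c] by (intro add_mono mult_right_mono) (auto simp: abs_mult)
    also have "\<dots> = 3 * (norm (\<rho> c) * norm (\<rho> c)) * norm (\<rho> a)" by simp
    also have "\<dots> \<le> 3 * (1/2 * (1/2)) * norm (\<rho> a)"
      using c by (intro mult_right_mono mult_left_mono mult_mono) auto
    finally show thesis using that[of v] v_int v_iso False by simp
  next
    case True
    \<comment> \<open>Otherwise \<open>v = 0\<close> makes \<open>a\<close> a multiple
      \<open>m\<close> of \<open>b\<close>, and isotropy of \<open>a\<close> forces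
      \<open>m = 0\<close>, hence \<open>a = 0\<close>.\<close>
    have "lorentz t b b = 0"
    proof (rule ccontr)
      assume bb: "lorentz t b b \<noteq> 0"
      define m where "m = 2 * lorentz t a b / lorentz t b b"
      have "lorentz t b b *\<^sub>R a = (2 * lorentz t a b) *\<^sub>R b"
        using True by (simp add: v_def)
      then have "inverse (lorentz t b b) *\<^sub>R lorentz t b b *\<^sub>R a
          = inverse (lorentz t b b) *\<^sub>R (2 * lorentz t a b) *\<^sub>R b" by simp
      then have am: "a = m *\<^sub>R b"
        using bb by (simp add: m_def divide_inverse mult.commute)
      then have "m * (m * lorentz t b b) = 0"
        using a(3) by (simp add: lorentz_simps)
      then show False using bb am a(2) by auto
    qed
    moreover have "norm (\<rho> b) \<le> 3/4 * norm (\<rho> a)"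
    proof -
      have "norm (\<rho> b) \<le> \<bar>l\<bar> * norm (\<rho> a) + norm (\<rho> c)"
        unfolding blc linear_add[OF lin] linear_scale[OF lin]
        by (rule order_trans[OF norm_triangle_ineq]) simp
      also have "\<dots> \<le> 1/2 * norm (\<rho> a) + 1/2"
        using l c by (intro add_mono mult_right_mono) auto
      finally show ?thesis using two by linarith
    qed
    ultimately show thesis using that[of b] b by blast
  qed
qed

text \<open>If all isotropic integer vectors were longer than the bound, the descent applied to one
  within a factor 4/3 of the infimum of the lengths would go below that infimum.\<close>

lemma short_isotropic_vector:
  fixes \<rho> :: "real ^ 'n::{finite,wellorder} \<Rightarrow> real ^ 'n::_"
  assumes lin: "linear \<rho>" and inv: "\<And>x. \<rho> (\<rho> x) = x"
    and isom: "\<And>x y. lorentz t (\<rho> x) (\<rho> y) = lorentz t x y"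
    and card: "CARD('n) \<ge> 2"
  obtains a where "a \<in> integer_vectors" "a \<noteq> 0" "lorentz t a a = 0"
    "norm (\<rho> a) \<le> 2 * (2 * CARD('n)) ^ (CARD('n) - 1)"
proof -
  define I where "I = {a \<in> integer_vectors. a \<noteq> 0 \<and> lorentz t a a = 0}"
  define K where "K = real (2 * (2 * CARD('n)) ^ (CARD('n) - 1))"
  define M where "M = (\<lambda>a. norm (\<rho> a)) ` I"
  have K: "K > 0" by (simp add: K_def)
  have "(UNIV :: 'n set) \<noteq> {t}"
  proof
    assume "(UNIV :: 'n set) = {t}"
    then have "CARD('n) = card {t}" by (rule arg_cong)
    then show False using card by simp
  qed
  then obtain j where j: "j \<noteq> t" by blast
  \<comment> \<open>The sum of the time axis and a space axis is a first isotropic vector;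
    \<open>card\<close> supplies the space axis.\<close>
  have "axis t 1 + axis j 1 \<in> I"
  proof -
    have "axis t 1 + axis j (1::real) \<in> integer_vectors"
      by (auto simp: integer_vectors_def axis_def)
    moreover have "(axis t 1 + axis j (1::real)) $ t = 1"
      using j by (simp add: axis_def)
    then have "axis t 1 + axis j (1::real) \<noteq> 0" by (metis zero_index zero_neq_one)
    moreover have "lorentz t (axis t 1 + axis j (1::real)) (axis t 1 + axis j 1) = 0"
      using j by (simp add: lorentz_def inner_simps inner_axis_axis) (simp add: axis_def)
    ultimately show ?thesis by (simp add: I_def)
  qed
  then have ne: "M \<noteq> {}" by (auto simp: M_def)
  have bdd: "bdd_below M" unfolding M_def by (rule bdd_belowI[of _ 0]) auto
  have "\<exists>a\<in>I. norm (\<rho> a) \<le> K"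
  proof (rule ccontr)
    assume "\<not> ?thesis"
    then have gt: "\<And>a. a \<in> I \<Longrightarrow> K < norm (\<rho> a)" by force
    then have "K \<le> Inf M" using ne by (intro cInf_greatest) (auto simp: M_def less_imp_le)
    then have "Inf M < 4/3 * Inf M" using K by simp
    then obtain a where a: "a \<in> I" "norm (\<rho> a) < 4/3 * Inf M"
      using cInf_lessD[OF ne] unfolding M_def by blast
    obtain a' where "a' \<in> I" "norm (\<rho> a') \<le> 3/4 * norm (\<rho> a)"
      using isotropic_descent[OF lin inv isom, of a] a(1) gt[OF a(1)] unfolding I_def K_def by blast
    then show False
      using a(2) cInf_lower[OF _ bdd, of "norm (\<rho> a')"] by (auto simp: M_def)
  qed
  then show thesis using that by (auto simp: I_def K_def)
qed

section \<open>Lorentz reflections and isotropic vectors near a hyperbolic point\<close>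

definition lorentz_reflection :: "'n \<Rightarrow> real ^ 'n \<Rightarrow> real ^ 'n \<Rightarrow> real ^ 'n" where
  "lorentz_reflection t w x = x - (2 * lorentz t x w / lorentz t w w) *\<^sub>R w"

lemma linear_lorentz_reflection: "linear (lorentz_reflection t w)"
  by (rule linearI)
    (simp_all add: lorentz_reflection_def lorentz_simps add_divide_distrib distrib_left
      scaleR_add_left scaleR_diff_right)

lemma lorentz_reflection_involution:
  "lorentz t w w \<noteq> 0 \<Longrightarrow> lorentz_reflection t w (lorentz_reflection t w x) = x"
  by (simp add: lorentz_reflection_def lorentz_simps diff_divide_distrib right_diff_distrib
      scaleR_diff_left)

lemma lorentz_lorentz_reflection:
  assumes "lorentz t w w \<noteq> 0"
  shows "lorentz t (lorentz_reflection t w x) (lorentz_reflection t w y) = lorentz t x y"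
proof -
  define k where "k = 2 * lorentz t x w / lorentz t w w"
  define m where "m = 2 * lorentz t y w / lorentz t w w"
  have k: "k * lorentz t w w = 2 * lorentz t x w" and m: "m * lorentz t w w = 2 * lorentz t y w"
    using assms by (simp_all add: k_def m_def)
  have "lorentz t (lorentz_reflection t w x) (lorentz_reflection t w y) =
      lorentz t x y - m * lorentz t x w - k * lorentz t y w + k * (m * lorentz t w w)"
    unfolding lorentz_reflection_def k_def[symmetric] m_def[symmetric] lorentz_simps
      lorentz_commute[of t w y] by (simp add: algebra_simps)
  moreover have "m * (k * lorentz t w w) = k * (m * lorentz t w w)"
    by simp
  ultimately show ?thesis unfolding k m by simp
qed

text \<open>Equal values of the form at \<open>x\<close> and \<open>y\<close> make the coefficient
  in the reflection equal to 1, so exactly \<open>x - y\<close> is subtracted from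
  \<open>x\<close>.\<close>

lemma lorentz_reflection_diff:
  assumes "lorentz t x x = lorentz t y y" "lorentz t (x - y) (x - y) \<noteq> 0"
  shows "lorentz_reflection t (x - y) x = y"
proof -
  have "2 * lorentz t x (x - y) = lorentz t (x - y) (x - y)"
    by (simp add: lorentz_simps assms(1) lorentz_commute[of t y x])
  then show ?thesis using assms(2) by (simp add: lorentz_reflection_def)
qed

lemma lorentz_axis: "lorentz t x (axis t 1) = - (x $ t)"
  by (simp add: lorentz_def inner_axis)

text \<open>On vectors with vanishing time coordinate the form is the inner product, which is
  positive definite.\<close>

lemma isotropic_time_nonzero:
  assumes "lorentz t a a = 0" "a \<noteq> 0"
  shows "a $ t \<noteq> 0"
  using assms by (auto simp: lorentz_def)

text \<open>The reflection in \<open>\<eta> - e\<close> takes \<open>\<eta>\<close> to the time axis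
  \<open>e\<close>, so \<open>lorentz t a \<eta>\<close> is, up to sign, the time coordinate of
  \<open>\<rho> a\<close>. The condition \<open>\<eta> $ t > 1\<close> keeps
  \<open>\<eta> - e\<close> from being isotropic.\<close>

lemma isotropic_vector_near_timelike:
  fixes \<eta> :: "real ^ 'n::{finite,wellorder}"
  assumes \<eta>: "lorentz t \<eta> \<eta> = -1" "\<eta> $ t > 1" and card: "CARD('n) \<ge> 2"
  obtains a where "a \<in> integer_vectors" "a $ t > 0" "lorentz t a a = 0"
    "\<bar>lorentz t a \<eta>\<bar> \<le> 2 * (2 * CARD('n)) ^ (CARD('n) - 1)"
proof -
  define e :: "real ^ 'n::_" where "e = axis t 1"
  define w where "w = \<eta> - e"
  define \<rho> where "\<rho> = lorentz_reflection t w"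
  have ee: "lorentz t e e = -1" by (simp add: e_def lorentz_axis)
  have "lorentz t w w = 2 * (\<eta> $ t) - 2"
    using \<eta> ee lorentz_axis[of t \<eta>] lorentz_commute[of t e \<eta>]
    by (simp add: w_def lorentz_simps e_def)
  then have ww: "lorentz t w w \<noteq> 0" using \<eta> by simp
  have \<rho>\<eta>: "\<rho> \<eta> = e"
    using lorentz_reflection_diff[of t \<eta> e] \<eta> ee ww by (simp add: \<rho>_def w_def)
  have isom: "lorentz t (\<rho> x) (\<rho> y) = lorentz t x y" for x y
    unfolding \<rho>_def by (rule lorentz_lorentz_reflection[OF ww])
  have inv: "\<rho> (\<rho> x) = x" for x
    unfolding \<rho>_def by (rule lorentz_reflection_involution[OF ww])
  have lin: "linear \<rho>"
    unfolding \<rho>_def by (rule linear_lorentz_reflection)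
  obtain a where a: "a \<in> integer_vectors" "a \<noteq> 0" "lorentz t a a = 0"
    "norm (\<rho> a) \<le> 2 * (2 * CARD('n)) ^ (CARD('n) - 1)"
    using short_isotropic_vector[OF lin inv isom card] by blast
  have "\<bar>lorentz t a \<eta>\<bar> = \<bar>\<rho> a $ t\<bar>"
    using isom[of a \<eta>] by (simp add: \<rho>\<eta> e_def lorentz_axis)
  then have le: "\<bar>lorentz t a \<eta>\<bar> \<le> 2 * (2 * CARD('n)) ^ (CARD('n) - 1)"
    using component_le_norm_cart[of "\<rho> a" t] a(4) by linarith
  \<comment> \<open>The time coordinate is to become a denominator, so \<open>a\<close> is replaced
    by \<open>- a\<close> if it is negative.\<close>
  define s :: real where "s = sgn (a $ t)"
  have s: "s \<in> \<int>" "\<bar>s\<bar> = 1" "s * a $ t > 0"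
    using isotropic_time_nonzero[OF a(3,2)] by (auto simp: s_def sgn_if)
  show thesis
  proof (rule that)
    show "s *\<^sub>R a \<in> integer_vectors" using s a by (intro integer_vectors_scaleR)
    show "(s *\<^sub>R a) $ t > 0" using s by simp
    show "lorentz t (s *\<^sub>R a) (s *\<^sub>R a) = 0" using a by (simp add: lorentz_simps)
    show "\<bar>lorentz t (s *\<^sub>R a) \<eta>\<bar> \<le> 2 * (2 * CARD('n)) ^ (CARD('n) - 1)"
      using le s by (simp add: lorentz_simps abs_mult)
  qed
qed

section \<open>Spacetime coordinates and rational points of the sphere\<close>

text \<open>The library's \<open>measure_linear_image\<close> needs a well-ordered index type, which \<open>'k\<close> need not be.\<close>

typedef 'k spacetime = "{..card (UNIV :: 'k set)}"
  by blast

instantiation spacetime :: (type) wellorder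
begin

definition less_eq_spacetime :: "'a spacetime \<Rightarrow> 'a spacetime \<Rightarrow> bool" where
  "x \<le> y \<longleftrightarrow> Rep_spacetime x \<le> Rep_spacetime y"

definition less_spacetime :: "'a spacetime \<Rightarrow> 'a spacetime \<Rightarrow> bool" where
  "x < y \<longleftrightarrow> Rep_spacetime x < Rep_spacetime y"

instance
proof
  fix P :: "'a spacetime \<Rightarrow> bool" and x
  assume step: "\<And>x. (\<And>y. y < x \<Longrightarrow> P y) \<Longrightarrow> P x"
  show "P x"
    by (rule measure_induct_rule[where f=Rep_spacetime], rule step) (simp add: less_spacetime_def)
qed (auto simp: less_eq_spacetime_def less_spacetime_def Rep_spacetime_inject)

end

lemma card_spacetime: "CARD('k spacetime) = CARD('k) + 1"
  using type_definition.card[OF type_definition_spacetime] by simp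

text \<open>An infinite \<open>'k\<close> has \<open>card\<close> 0, so the cardinality is positive,
  and the type finite, for every \<open>'k\<close>.\<close>

instance spacetime :: (type) finite
  by standard (simp add: card_spacetime card_ge_0_finite)

text \<open>The left side of the bound is \<open>- 2 * T * lorentz t a \<eta>\<close> for the
  isotropic vector \<open>a\<close> with time part \<open>q\<close> and space part \<open>q\<close>
  times the rational point: \<open>2 * T * ch\<close> is \<open>T\<^sup>2 + 1\<close> and
  \<open>2 * T * sh\<close> is \<open>T\<^sup>2 - 1\<close>.\<close>

lemma isotropic_point_on_sphere:
  fixes \<alpha> :: "real ^ 'k" and T :: real
  assumes \<alpha>: "norm \<alpha> = 1" and T: "T > 1"
  obtains p :: "int ^ 'k" and q :: nat where "q > 0" "norm (rational_point p q) = 1"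
    "T\<^sup>2 * (q - q * (\<alpha> \<bullet> rational_point p q)) + (q + q * (\<alpha> \<bullet> rational_point p q))
      \<le> 2 * T * (2 * (2 * CARD('k) + 2) ^ CARD('k))"
proof -
  obtain t :: "'k spacetime" where True by blast
  have "card (UNIV :: 'k set) = card (UNIV - {t})"
    by (simp add: card_Diff_singleton card_spacetime)
  \<comment> \<open>\<open>\<beta>\<close> labels the space coordinates by \<open>'k\<close>, and
    \<open>\<gamma>\<close> undoes it; \<open>sp\<close> will be the space part.\<close>
  then obtain \<beta> where \<beta>: "bij_betw \<beta> (UNIV :: 'k set) (UNIV - {t})"
    using finite_same_card_bij[of "UNIV :: 'k set" "UNIV - {t}"] by auto
  define \<gamma> where "\<gamma> = the_inv_into UNIV \<beta>"
  have \<gamma>: "\<gamma> (\<beta> j) = j" for j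
    using \<beta> by (simp add: \<gamma>_def bij_betw_def the_inv_into_f_f)
  have \<beta>t: "\<beta> j \<noteq> t" for j using \<beta> by (auto simp: bij_betw_def)
  define sp where "sp x = (\<chi> j. x $ \<beta> j)" for x :: "real ^ 'k spacetime"
  have lor: "lorentz t x y = sp x \<bullet> sp y - x $ t * y $ t" for x y
  proof -
    have "x \<bullet> y = x $ t * y $ t + (\<Sum>i\<in>UNIV - {t}. x $ i * y $ i)"
      unfolding inner_vec_def by (subst sum.remove[of UNIV t]) auto
    also have "(\<Sum>i\<in>UNIV - {t}. x $ i * y $ i) = sp x \<bullet> sp y"
      by (simp add: inner_vec_def sp_def sum.reindex_bij_betw[OF \<beta>, symmetric])
    finally show ?thesis by (simp add: lorentz_def)
  qed
  define ch where "ch = (T + 1 / T) / 2"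
  define sh where "sh = (T - 1 / T) / 2"
  \<comment> \<open>the hyperbolic point \<open>(sinh s \<alpha>, cosh s)\<close> with \<open>s = ln T\<close>\<close>
  define \<eta> where "\<eta> = (\<chi> i. if i = t then ch else sh * \<alpha> $ \<gamma> i)"
  have sp\<eta>: "sp \<eta> = sh *\<^sub>R \<alpha>" by (simp add: sp_def \<eta>_def \<beta>t \<gamma> vec_eq_iff)
  have \<eta>t: "\<eta> $ t = ch" by (simp add: \<eta>_def)
  have hyp: "sh * sh - ch * ch = -1" using T by (simp add: ch_def sh_def field_simps)
  have "\<alpha> \<bullet> \<alpha> = 1" using \<alpha> by (simp add: dot_square_norm)
  then have "lorentz t \<eta> \<eta> = -1" using hyp by (simp add: lor sp\<eta> \<eta>t)
  moreover have "\<eta> $ t > 1"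
  proof -
    have "(T - 1)\<^sup>2 > 0" using T by simp
    then show ?thesis using T by (simp add: \<eta>t ch_def field_simps power2_eq_square)
  qed
  moreover have "CARD('k spacetime) \<ge> 2" by (simp add: card_spacetime Suc_leI)
  ultimately obtain a where a: "a \<in> integer_vectors" "a $ t > 0" "lorentz t a a = 0"
    "\<bar>lorentz t a \<eta>\<bar> \<le> 2 * (2 * CARD('k spacetime)) ^ (CARD('k spacetime) - 1)"
    using isotropic_vector_near_timelike[of t \<eta>] by blast
  define q where "q = nat \<lfloor>a $ t\<rfloor>"
  define p where "p = (\<chi> j. \<lfloor>a $ \<beta> j\<rfloor>)"
  have fl: "of_int \<lfloor>a $ i\<rfloor> = a $ i" for i
    using a(1) by (simp add: integer_vectors_def)
  have "\<lfloor>a $ t\<rfloor> > 0" using a(2) fl[of t] by linarith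
  then have q: "q > 0" "real q = a $ t"
    using fl[of t] by (simp_all add: q_def)
  have spa: "sp a = q *\<^sub>R rational_point p q"
    using q(1) by (simp add: sp_def rational_point_def p_def fl vec_eq_iff)
  define r where "r = rational_point p q"
  have "(real q * real q) * (r \<bullet> r - 1) = 0"
    using a(3) q by (simp add: lor spa r_def algebra_simps)
  then have "norm r = 1" using q by (simp add: norm_eq_sqrt_inner)
  have "ch * q - sh * (q * (\<alpha> \<bullet> r)) = - lorentz t a \<eta>"
    using q by (simp add: lor spa sp\<eta> \<eta>t r_def inner_commute)
  also have "\<dots> \<le> 2 * (2 * CARD('k spacetime)) ^ (CARD('k spacetime) - 1)"
    using a(4) by linarith
  also have "\<dots> = 2 * (2 * CARD('k) + 2) ^ CARD('k)"
    by (simp add: card_spacetime)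
  finally have "2 * T * (ch * q - sh * (q * (\<alpha> \<bullet> r))) \<le> 2 * T * (2 * (2 * CARD('k) + 2) ^ CARD('k))"
    using T by (intro mult_left_mono) auto
  moreover have "2 * T * (ch * q - sh * (q * (\<alpha> \<bullet> r))) =
      T\<^sup>2 * (q - q * (\<alpha> \<bullet> r)) + (q + q * (\<alpha> \<bullet> r))"
    using T by (simp add: ch_def sh_def field_simps power2_eq_square)
  ultimately show thesis using that[of q p] q \<open>norm r = 1\<close> by (simp add: r_def)
qed

section \<open>The uniform Dirichlet bound with explicit constant\<close>

theorem theorem4p1:
  fixes n :: nat
  assumes "n \<ge> 1" and "CARD('k::finite) = n + 1"
  shows "\<exists>C::real. \<forall>\<alpha> \<in> sphere (0 :: real ^ 'k) 1.
           uniformly_Dirichlet C (1/2) (1/2) (sphere 0 1) \<alpha>"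
proof -
  define K :: real where "K = 2 * (2 * CARD('k) + 2) ^ CARD('k)"
  have "1 \<le> (2 * real CARD('k) + 2) ^ CARD('k)" by (rule one_le_power) simp
  then have K: "K \<ge> 2" by (simp add: K_def)
  have "\<exists>(p :: int ^ 'k) (q :: nat). q > 0 \<and> rational_point p q \<in> sphere 0 1 \<and> real q \<le> N \<and>
      infnorm (\<alpha> - rational_point p q) < 4 * K / (real q powr (1/2) * N powr (1/2))"
    if \<alpha>: "\<alpha> \<in> sphere (0 :: real ^ 'k) 1" and N: "N > 1" for \<alpha> and N :: real
  proof -
    have n\<alpha>: "norm \<alpha> = 1" using \<alpha> by simp
    \<comment> \<open>The supremum norm is at most the Euclidean one, so a squared Euclidean
      estimate suffices.\<close>
    have bound: "infnorm (\<alpha> - rational_point p q) < 4 * K / (real q powr (1/2) * N powr (1/2))"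
      if q: "q > 0" and d: "q * N * (norm (\<alpha> - rational_point p q))\<^sup>2 < (4 * K)\<^sup>2"
      for p :: "int ^ 'k" and q :: nat
    proof -
      have pos: "0 < sqrt (q * N)" using q N by simp
      have "(sqrt (q * N) * norm (\<alpha> - rational_point p q))\<^sup>2 < (4 * K)\<^sup>2"
        using d q N by (simp add: power_mult_distrib)
      then have "sqrt (q * N) * norm (\<alpha> - rational_point p q) < 4 * K"
        by (rule power2_less_imp_less) (use K in simp)
      then have "norm (\<alpha> - rational_point p q) < 4 * K / sqrt (q * N)"
        using pos by (simp add: pos_less_divide_eq mult.commute)
      also have "sqrt (q * N) = real q powr (1/2) * N powr (1/2)"
        using q N by (simp add: powr_half_sqrt real_sqrt_mult)
      finally show ?thesis using infnorm_le_norm order_le_less_trans by blast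
    qed
    show ?thesis
    proof (cases "N > 2 * K")
      case True
      \<comment> \<open>Chosen so that the bound \<open>2 * T * K\<close> for the rational point
        becomes \<open>N\<close>.\<close>
      define T where "T = N / (2 * K)"
      have T: "T > 1" "2 * T * K = N" using True K by (simp_all add: T_def)
      obtain p :: "int ^ 'k" and q :: nat where q: "q > 0" and r: "norm (rational_point p q) = 1"
        and le: "T\<^sup>2 * (q - q * (\<alpha> \<bullet> rational_point p q)) + (q + q * (\<alpha> \<bullet> rational_point p q)) \<le> N"
        using isotropic_point_on_sphere[OF n\<alpha> T(1)] T(2) unfolding K_def by (metis (no_types, lifting))
      define D where "D = \<alpha> \<bullet> rational_point p q"
      have "\<bar>D\<bar> \<le> 1"
        using Cauchy_Schwarz_ineq2[of \<alpha> "rational_point p q"] n\<alpha> r by (simp add: D_def)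
      then have D: "q - q * D \<ge> 0" "q + q * D \<ge> 0"
        using mult_left_mono[of D 1 q] mult_left_mono[of "-1" D q] by (simp_all add: abs_le_iff)
      \<comment> \<open>Replacing \<open>T\<^sup>2\<close> by 1 leaves
        \<open>2 * q \<le> N\<close>.\<close>
      have "1 * (q - q * D) \<le> T\<^sup>2 * (q - q * D)"
        using T D by (intro mult_right_mono) (auto simp: one_le_power)
      then have "(q - q * D) + (q + q * D) \<le> T\<^sup>2 * (q - q * D) + (q + q * D)" by simp
      also have "\<dots> \<le> N" using le by (simp only: D_def)
      finally have "real q \<le> N" using N by simp
      moreover have "q * N * (norm (\<alpha> - rational_point p q))\<^sup>2 < (4 * K)\<^sup>2"
      proof -
        \<comment> \<open>Hence \<open>q\<close> times the squared distance is
          \<open>2 * (q - q * D)\<close>, at most \<open>2 * N / T\<^sup>2\<close>; with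
          \<open>N = 2 * T * K\<close> a further factor \<open>N\<close> gives
          \<open>8 * K\<^sup>2\<close>.\<close>
        have norm_eq: "(norm (\<alpha> - rational_point p q))\<^sup>2 = 2 - 2 * D"
          using n\<alpha> r dot_norm_neg[of \<alpha> "rational_point p q"] by (simp add: D_def)
        have "T\<^sup>2 * (q * N * (norm (\<alpha> - rational_point p q))\<^sup>2) = 2 * N * (T\<^sup>2 * (q - q * D))"
          unfolding norm_eq by (simp add: algebra_simps)
        also have "\<dots> \<le> 2 * N * N"
        proof (rule mult_left_mono)
          show "T\<^sup>2 * (q - q * D) \<le> N" using le D(2) unfolding D_def[symmetric] by linarith
        qed (use N in simp)
        also have "\<dots> = T\<^sup>2 * (8 * K\<^sup>2)"
          unfolding T(2)[symmetric] by (simp add: power2_eq_square)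
        finally have "q * N * (norm (\<alpha> - rational_point p q))\<^sup>2 \<le> 8 * K\<^sup>2"
          using T by simp
        also have "\<dots> < (4 * K)\<^sup>2" using K by (simp add: power_mult_distrib)
        finally show ?thesis .
      qed
      ultimately show ?thesis using q r bound by auto
    next
      case False
      \<comment> \<open>For bounded \<open>N\<close> denominator 1 suffices: any coordinate unit
        vector lies within distance 2 of \<open>\<alpha>\<close>.\<close>
      obtain j :: 'k where True by blast
      define p :: "int ^ 'k" where "p = axis j 1"
      have p: "rational_point p 1 = axis j 1"
        by (auto simp: rational_point_def p_def axis_def vec_eq_iff)
      have "norm (\<alpha> - rational_point p 1) \<le> 2"
        using norm_triangle_ineq4[of \<alpha> "rational_point p 1"] n\<alpha> p by (simp add: norm_axis_1)
      then have "(norm (\<alpha> - rational_point p 1))\<^sup>2 \<le> 2\<^sup>2" by (intro power_mono) auto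
      then have "N * (norm (\<alpha> - rational_point p 1))\<^sup>2 \<le> (2 * K) * 2\<^sup>2"
        using False N K by (intro mult_mono) auto
      also have "\<dots> < (4 * K)\<^sup>2" using K by (simp add: power2_eq_square)
      finally have "infnorm (\<alpha> - rational_point p 1) < 4 * K / (real 1 powr (1/2) * N powr (1/2))"
        using bound[of 1 p] by simp
      then show ?thesis using p N by (intro exI[of _ p] exI[of _ 1]) (auto simp: norm_axis_1)
    qed
  qed
  then show ?thesis unfolding uniformly_Dirichlet_def by (intro exI[of _ "4 * K"]) auto
qed

end
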